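(* Let $n,r\ge 1$ be integers and let $A,B_1,\dots,B_n,C$ be positive stable matrices in $\mathbb{C}^{r\times r}$ such that $\alpha(A)<\beta(C)$ and $\alpha(B_i)<1$ for $i=1,\dots,n$. Then the series $$F_{\mathcal{D}}[A,B_1,\dots,B_n;C;x_1,\dots,x_n]=\sum_{m_1,\dots,m_n=0}^{\infty}(A)_{m_1+\cdots+m_n}(B_1)_{m_1}\cdots(B_n)_{m_n}(C)_{m_1+\cdots+m_n}^{-1}\,\frac{x_1^{m_1}\cdots x_n^{m_n}}{m_1!\cdots m_n!}$$ converges absolutely for all $x_1,\dots,x_n\in\mathbb{C}$ with $|x_1|<1,\dots,|x_n|<1$.
   Context: For $M\in\mathbb{C}^{r\times r}$ with spectrum $\sigma(M)$, $\alpha(M)=\max\{\Re(z):z\in\sigma(M)\}$ and $\beta(M)=\min\{\Re(z):z\in\sigma(M)\}$; $M$ is positive stable if $\beta(M)>0$. The Pochhammer symbol is $(M)_0=I$ and $(M)_k=M(M+I)\cdots(M+(k-1)I)$ for $k\ge1$; $(M)_k^{-1}$ denotes the inverse matrix of $(M)_k$. Matrix products are taken in the written order (no commutativity is assumed). Absolute convergence means that the series of norms of the terms converges. *)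

theory Defs
  imports "HOL-Analysis.Analysis"
begin

definition spectrum :: "complex ^ 'r ^ 'r \<Rightarrow> complex set" where
  "spectrum M = {z. \<exists>v. v \<noteq> 0 \<and> M *v v = z *s v}"

(* The spectrum of a complex square matrix is finite and nonempty (the index type
   is nonempty), so Max and Min are genuine extrema here. *)
definition spec_alpha :: "complex ^ 'r ^ 'r \<Rightarrow> real" where
  "spec_alpha M = Max (Re ` spectrum M)"

definition spec_beta :: "complex ^ 'r ^ 'r \<Rightarrow> real" where
  "spec_beta M = Min (Re ` spectrum M)"

definition positive_stable :: "complex ^ 'r ^ 'r \<Rightarrow> bool" where
  "positive_stable M \<longleftrightarrow> spec_beta M > 0"

(* mat (of_nat k) is the matrix k I. *)
primrec mat_pochhammer :: "complex ^ 'r ^ 'r \<Rightarrow> nat \<Rightarrow> complex ^ 'r ^ 'r" where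
  "mat_pochhammer M 0 = mat 1"
| "mat_pochhammer M (Suc k) = mat_pochhammer M k ** (M + mat (of_nat k))"

(* The product F 1 ** F 2 ** ... ** F n, in this order. *)
primrec mat_prod_upto :: "(nat \<Rightarrow> complex ^ 'r ^ 'r) \<Rightarrow> nat \<Rightarrow> complex ^ 'r ^ 'r" where
  "mat_prod_upto F 0 = mat 1"
| "mat_prod_upto F (Suc n) = mat_prod_upto F n ** F (Suc n)"

(* The term of index m = (m 1, ..., m n); only the values of B, x and m on {1..n} matter. *)
definition FD_term ::
  "nat \<Rightarrow> complex ^ 'r ^ 'r \<Rightarrow> (nat \<Rightarrow> complex ^ 'r ^ 'r) \<Rightarrow> complex ^ 'r ^ 'r \<Rightarrow>
     (nat \<Rightarrow> complex) \<Rightarrow> (nat \<Rightarrow> nat) \<Rightarrow> complex ^ 'r ^ 'r" where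
  "FD_term n A B C x m =
     map_matrix ((*) ((\<Prod>i=1..n. x i ^ m i) / (\<Prod>i=1..n. fact (m i))))
       (mat_pochhammer A (\<Sum>i=1..n. m i)
        ** mat_prod_upto (\<lambda>i. mat_pochhammer (B i) (m i)) n
        ** matrix_inv (mat_pochhammer C (\<Sum>i=1..n. m i)))"

(* Multi-indices as functions with domain {1..n}, extensional outside it, so that
   each element of nat^n is represented exactly once. *)
definition multi_indices :: "nat \<Rightarrow> (nat \<Rightarrow> nat) set" where
  "multi_indices n = {1..n} \<rightarrow>\<^sub>E UNIV"

end

theory Submission
  imports Defs "HOL-Computational_Algebra.Polynomial" "HOL-Real_Asymp.Real_Asymp"
begin

text \<open>
  On the open unit polydisc the terms are dominated by a convergent multiple geometric series as
  soon as their coefficients grow slower than every exponential. The latter holds because the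
  matrix factors of the Pochhammer symbols behave like scalars for large \<open>j\<close>: in the
  operator norm, both \<open>(M + j I) / (j + 1)\<close> and its inverse have norms bounded by ratios
  \<open>(j + a) / (j + b)\<close> tending to \<open>1\<close>. Taking products over \<open>j < k\<close>,
  for each \<open>q > 1\<close> one obtains a constant \<open>K\<close> such that \<open>(M)\<^sub>k\<close> has norm
  at most \<open>K q^k k!\<close> (lemma \<open>mat_pochhammer_growth\<close>) and \<open>(C)\<^sub>k\<close> has an
  inverse of norm at most \<open>K q^k / k!\<close> (lemma \<open>inverse_mat_pochhammer_growth\<close>).

  The existence of the inverses is a spectral fact: if \<open>C + j I\<close> were singular, then
  \<open>-j\<close> would be an eigenvalue of \<open>C\<close> with nonpositive real part, against positive stability
  (lemma \<open>positive_stable_imp_invertible_shift\<close>).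

  In a term of total degree \<open>k = m\<^sub>1 + \<dots> + m\<^sub>n\<close> the factorials \<open>k!\<close> from \<open>A\<close>
  and \<open>1 / k!\<close> from \<open>C\<close> cancel, and the factorials \<open>m\<^sub>i!\<close> from the
  \<open>B\<^sub>i\<close> cancel against the denominators. If \<open>s < 1\<close> is the largest of the
  \<open>\<bar>x\<^sub>i\<bar>\<close>, the term is thus at most a constant times \<open>(q\<^sup>3 s)^k\<close>, and \<open>q\<close> can be
  chosen so close to \<open>1\<close> that \<open>q\<^sup>3 s < 1\<close>.
\<close>

section \<open>Spectrum and invertibility of shifts\<close>

lemma norm_smult: "norm (z *s (v :: complex ^ 'n)) = norm z * norm v"
  by (simp add: norm_vec_def norm_mult L2_set_right_distrib)

lemma add_mat_vector_mult: "(M + mat z) *v v = M *v v + z *s (v :: complex ^ 'n)"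
proof -
  have "mat z *v v = z *s v"
    by (vector matrix_vector_mult_def mat_def)
       (simp add: if_distrib if_distribR cong: if_cong)
  then show ?thesis by (simp add: matrix_vector_mult_add_rdistrib)
qed

text \<open>
  The eigenvalues are the zeros of the characteristic polynomial, that is of the determinant of a
  matrix with polynomial entries. It is not the zero polynomial because no eigenvalue exceeds the
  operator norm in modulus. Finiteness is what turns the \<open>Min\<close> in the definition of
  \<open>spec_beta\<close> into a lower bound for the real parts of the eigenvalues.
\<close>
lemma finite_spectrum:
  fixes M :: "complex ^ 'r ^ 'r"
  shows "finite (spectrum M)"
proof -
  define P :: "complex poly ^ 'r ^ 'r"
    where "P = (\<chi> i j. [:M $ i $ j:] - (if i = j then [:0, 1:] else 0))"
  have poly_det: "poly (det P) z = det (M + mat (- z))" for z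
    unfolding det_def poly_sum poly_mult poly_prod
    by (intro sum.cong prod.cong arg_cong2[where f = "(*)"])
       (auto simp: P_def mat_def sign_def)
  have spec_iff: "z \<in> spectrum M \<longleftrightarrow> poly (det P) z = 0" for z
  proof -
    have "z \<in> spectrum M \<longleftrightarrow> \<not> invertible (M + mat (- z))"
      unfolding spectrum_def invertible_left_inverse matrix_left_invertible_ker add_mat_vector_mult
      by (auto simp: vector_smult_lneg)
    then show ?thesis by (simp add: poly_det invertible_det_nz)
  qed
  define w where "w = (of_real (onorm ((*v) M) + 1) :: complex)"
  have "w \<notin> spectrum M"
  proof
    assume "w \<in> spectrum M"
    then obtain v where v: "v \<noteq> 0" "M *v v = w *s v" by (auto simp: spectrum_def)
    have "norm w * norm v \<le> onorm ((*v) M) * norm v"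
      using onorm[OF matrix_vector_mul_bounded_linear, of M v] by (simp add: v norm_smult)
    moreover have "norm w = onorm ((*v) M) + 1"
      using onorm_pos_le[OF matrix_vector_mul_bounded_linear, of M] unfolding w_def norm_of_real by linarith
    ultimately show False using v by simp
  qed
  then have "det P \<noteq> 0" by (auto simp: spec_iff)
  then show ?thesis
    using poly_roots_finite[of "det P"] by (simp add: spec_iff[symmetric])
qed

lemma positive_stable_imp_invertible_shift:
  fixes C :: "complex ^ 'r ^ 'r"
  assumes "positive_stable C"
  shows "invertible (C + mat (of_nat j))"
proof -
  have "v = 0" if "C *v v + of_nat j *s v = 0" for v
  proof (rule ccontr)
    assume "v \<noteq> 0"
    with that have "- of_nat j \<in> spectrum C"
      by (auto simp: spectrum_def eq_neg_iff_add_eq_0 vector_smult_lneg)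
    then have "spec_beta C \<le> Re (- of_nat j)"
      unfolding spec_beta_def by (intro Min_le imageI) (auto simp only: finite_spectrum finite_imageI)
    then show False using assms by (simp add: positive_stable_def)
  qed
  then show ?thesis
    unfolding invertible_left_inverse matrix_left_invertible_ker add_mat_vector_mult by blast
qed

section \<open>Products of factors that are eventually close to one\<close>

text \<open>
  Only finitely many factors can exceed \<open>q\<close>; the constant collects these.
\<close>
lemma prod_le_const_power:
  fixes u :: "nat \<Rightarrow> real"
  assumes le: "\<forall>\<^sub>F j in sequentially. u j \<le> q" and pos: "\<And>j. u j \<ge> 0" and q: "q \<ge> 1"
  shows "\<exists>K\<ge>0. \<forall>k. (\<Prod>j<k. u j) \<le> K * q ^ k"
proof -
  obtain N where N: "\<And>j. j \<ge> N \<Longrightarrow> u j \<le> q"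
    using le unfolding eventually_sequentially by blast
  define K where "K = (\<Prod>j<N. max 1 (u j))"
  \<comment> \<open>A bound by \<open>K * q ^ k\<close> itself is not inductive: the factors exceeding \<open>q\<close> must be
    collected one at a time.\<close>
  have "(\<Prod>j<k. u j) \<le> (\<Prod>j<k. max 1 (if j < N then u j else 1)) * q ^ k" for k
  proof (induction k)
    case (Suc k)
    have "u k \<le> max 1 (if k < N then u k else 1) * q"
      using N[of k] q mult_left_mono[of 1 q "u k"] pos[of k] by (auto simp: max_def)
    with Suc have "(\<Prod>j<k. u j) * u k \<le>
        ((\<Prod>j<k. max 1 (if j < N then u j else 1)) * q ^ k) * (max 1 (if k < N then u k else 1) * q)"
      using q by (intro mult_mono) (auto intro!: prod_nonneg pos mult_nonneg_nonneg)
    then show ?case by (simp add: mult_ac)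
  qed simp
  moreover have "(\<Prod>j<k. max 1 (if j < N then u j else 1)) \<le> K" for k
  proof -
    have "(\<Prod>j<k. max 1 (if j < N then u j else 1)) = (\<Prod>j\<in>{..<k} \<inter> {..<N}. max 1 (u j))"
      by (rule prod.mono_neutral_cong_right) auto
    also have "\<dots> \<le> K" unfolding K_def by (rule prod_mono2) auto
    finally show ?thesis .
  qed
  ultimately have "(\<Prod>j<k. u j) \<le> K * q ^ k" for k
    using q by (meson mult_right_mono order_trans zero_le_power less_imp_le zero_less_one less_trans)
  moreover have "K \<ge> 0" unfolding K_def by (intro prod_nonneg) auto
  ultimately show ?thesis by blast
qed

section \<open>The operator norm of a matrix\<close>

text \<open>
  The Euclidean norm of a matrix gives the identity matrix the value \<open>sqrt r\<close>, which would
  contribute an exponential factor to a product of \<open>k\<close> matrices close to the identity. The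
  operator norm does not have this defect, and the two norms are compared only once per term, by
  \<open>norm_le_opnorm\<close>.
\<close>
abbreviation opnorm :: "complex ^ 'n ^ 'm \<Rightarrow> real" where
  "opnorm M \<equiv> onorm ((*v) M)"

lemma opnorm_nonneg: "opnorm M \<ge> 0"
  by (rule onorm_pos_le) simp

lemma opnorm_mult: "opnorm (M ** N) \<le> opnorm M * opnorm N"
  using onorm_compose[of "(*v) M" "(*v) N"] by (simp add: o_def matrix_vector_mul_assoc)

lemma norm_vec_le_sum: "norm (v :: 'a::real_normed_vector ^ 'n) \<le> (\<Sum>i\<in>UNIV. norm (v $ i))"
  by (simp add: norm_vec_def L2_set_le_sum)

lemma norm_le_opnorm:
  fixes M :: "complex ^ 'n ^ 'm"
  shows "norm M \<le> real CARD('m) * real CARD('n) * opnorm M"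
proof -
  have "norm (M $ i $ j) \<le> opnorm M" for i j
  proof -
    have "norm (M $ i $ j) = norm ((M *v axis j 1) $ i)"
      by (simp add: matrix_vector_mult_def axis_def if_distrib cong: if_cong)
    also have "\<dots> \<le> norm (M *v axis j 1)" by (rule Finite_Cartesian_Product.norm_nth_le)
    also have "\<dots> \<le> opnorm M * norm (axis j 1 :: complex ^ 'n)"
      by (rule onorm) simp
    finally show ?thesis by (simp add: norm_axis_1)
  qed
  then have "(\<Sum>i\<in>UNIV. \<Sum>j\<in>UNIV. norm (M $ i $ j)) \<le> (\<Sum>i\<in>(UNIV :: 'm set). \<Sum>j\<in>(UNIV :: 'n set). opnorm M)"
    by (intro sum_mono)
  moreover have "norm M \<le> (\<Sum>i\<in>UNIV. \<Sum>j\<in>UNIV. norm (M $ i $ j))"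
    by (rule order_trans[OF norm_vec_le_sum sum_mono[OF norm_vec_le_sum]])
  ultimately show ?thesis by simp
qed

section \<open>Subexponential growth of Pochhammer symbols and their inverses\<close>

lemma eventually_shifted_ratio_le:
  fixes a b q :: real
  assumes "q > 1"
  shows "\<forall>\<^sub>F j in sequentially. (real j + a) / (real j + b) \<le> q"
proof -
  have "(\<lambda>j. (real j + a) / (real j + b)) \<longlonglongrightarrow> 1" by real_asymp
  then show ?thesis
    using assms by (rule eventually_mono[OF order_tendstoD(2)]) simp
qed

text \<open>
  The \<open>j\<close>-th factor has norm at most \<open>j + \<parallel>M\<parallel>\<close>, and
  \<open>(j + \<parallel>M\<parallel>) / (j + 1)\<close> tends to \<open>1\<close>.
\<close>
lemma mat_pochhammer_growth:
  fixes M :: "complex ^ 'r ^ 'r"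
  assumes "q > 1"
  shows "\<exists>K\<ge>0. \<forall>k. opnorm (mat_pochhammer M k) \<le> K * q ^ k * fact k"
proof -
  define u where "u j = (real j + opnorm M) / (real j + 1)" for j
  have u0: "u j \<ge> 0" for j using opnorm_nonneg[of M] by (simp add: u_def)
  have "\<forall>\<^sub>F j in sequentially. u j \<le> q"
    unfolding u_def using assms by (rule eventually_shifted_ratio_le)
  from prod_le_const_power[OF this u0] assms
  obtain K where K: "K \<ge> 0" "\<And>k. (\<Prod>j<k. u j) \<le> K * q ^ k" by auto
  have shift: "opnorm (M + mat (of_nat j)) \<le> u j * (real j + 1)" for j
  proof (rule onorm_le)
    fix v
    have "norm ((M + mat (of_nat j)) *v v) \<le> norm (M *v v) + real j * norm v"
      unfolding add_mat_vector_mult by (rule norm_triangle_le) (simp add: norm_smult)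
    also have "norm (M *v v) \<le> opnorm M * norm v" by (rule onorm) simp
    also have "opnorm M * norm v + real j * norm v = u j * (real j + 1) * norm v"
    proof -
      have "u j * (real j + 1) = real j + opnorm M" by (simp add: u_def)
      then show ?thesis by (simp add: distrib_right)
    qed
    finally show "norm ((M + mat (of_nat j)) *v v) \<le> u j * (real j + 1) * norm v"
      by simp
  qed
  have "opnorm (mat_pochhammer M k) \<le> (\<Prod>j<k. u j) * fact k" for k
  proof (induction k)
    case 0 then show ?case by (simp add: onorm_id_le)
  next
    case (Suc k)
    have "opnorm (mat_pochhammer M (Suc k)) \<le> opnorm (mat_pochhammer M k) * opnorm (M + mat (of_nat k))"
      by (simp add: opnorm_mult)
    also have "\<dots> \<le> ((\<Prod>j<k. u j) * fact k) * (u k * (real k + 1))"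
      using Suc shift u0 by (intro mult_mono) (auto intro!: prod_nonneg mult_nonneg_nonneg opnorm_nonneg)
    finally show ?case by (simp add: algebra_simps)
  qed
  moreover have "(\<Prod>j<k. u j) * fact k \<le> K * q ^ k * fact k" for k
    using K(2) by (rule mult_right_mono) simp
  ultimately have "opnorm (mat_pochhammer M k) \<le> K * q ^ k * fact k" for k
    by (rule order_trans)
  then show ?thesis using K(1) by blast
qed

lemma matrix_inv_left_right:
  fixes M :: "'a::semiring_1 ^ 'n ^ 'm"
  assumes "invertible M"
  shows matrix_inv_right: "M ** matrix_inv M = mat 1"
    and matrix_inv_left: "matrix_inv M ** M = mat 1"
  using someI_ex[OF assms[unfolded invertible_def]] by (simp_all add: matrix_inv_def)

lemma matrix_inv_mult:
  fixes M N :: "complex ^ 'n ^ 'n"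
  assumes "invertible M" "invertible N"
  shows "matrix_inv (M ** N) = matrix_inv N ** matrix_inv M"
proof -
  have "M ** N ** (matrix_inv N ** matrix_inv M) = mat 1"
    by (metis assms matrix_inv_right matrix_mul_assoc matrix_mul_rid)
  then have "matrix_inv (M ** N) ** (M ** N ** (matrix_inv N ** matrix_inv M)) = matrix_inv (M ** N)"
    by simp
  moreover have "matrix_inv (M ** N) ** (M ** N) = mat 1"
    by (rule matrix_inv_left[OF invertible_mult[OF assms]])
  ultimately show ?thesis by (simp add: matrix_mul_assoc)
qed

text \<open>
  For \<open>j > \<parallel>C\<parallel>\<close>, the estimate \<open>\<parallel>(C + j I) v\<parallel> \<ge> (j - \<parallel>C\<parallel>) \<parallel>v\<parallel>\<close> bounds the norm of
  the inverse of the \<open>j\<close>-th factor by \<open>1 / (j - \<parallel>C\<parallel>)\<close>. For the finitely many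
  smaller \<open>j\<close> it is enough that the inverse exists.
\<close>
lemma inverse_mat_pochhammer_growth:
  fixes C :: "complex ^ 'r ^ 'r"
  assumes inv: "\<And>j. invertible (C + mat (of_nat j))" and "q > 1"
  shows "\<exists>K\<ge>0. \<forall>k. opnorm (matrix_inv (mat_pochhammer C k)) \<le> K * q ^ k / fact k"
proof -
  define u where "u j = opnorm (matrix_inv (C + mat (of_nat j))) * (real j + 1)" for j
  define c where "c = opnorm C"
  have u0: "u j \<ge> 0" for j unfolding u_def by (intro mult_nonneg_nonneg opnorm_nonneg) simp
  have upper: "u j \<le> (real j + 1) / (real j - c)" if j: "real j > c" for j
  proof -
    have "norm (matrix_inv (C + mat (of_nat j)) *v w) \<le> 1 / (real j - c) * norm w" for w
    proof -
      define v where "v = matrix_inv (C + mat (of_nat j)) *v w"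
      have w: "w = C *v v + of_nat j *s v"
        unfolding add_mat_vector_mult[symmetric] v_def
        by (simp add: matrix_vector_mul_assoc matrix_inv_right inv)
      have "real j * norm v = norm (w - C *v v)" by (simp add: w norm_smult)
      also have "\<dots> \<le> norm w + norm (C *v v)" by (rule norm_triangle_ineq4)
      also have "norm (C *v v) \<le> c * norm v" unfolding c_def by (rule onorm) simp
      finally show ?thesis using j unfolding v_def[symmetric] by (simp add: field_simps)
    qed
    from onorm_le[OF this] show ?thesis
      unfolding u_def by (auto dest: mult_right_mono[of _ _ "real j + 1"])
  qed
  have "\<forall>\<^sub>F j in sequentially. (real j + 1) / (real j - c) \<le> q"
    using eventually_shifted_ratio_le[OF assms(2), of 1 "- c"] by simp
  moreover have "\<forall>\<^sub>F j in sequentially. real j > c" by real_asymp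
  ultimately have "\<forall>\<^sub>F j in sequentially. u j \<le> q"
    by eventually_elim (use upper in fastforce)
  from prod_le_const_power[OF this u0] assms(2)
  obtain K where K: "K \<ge> 0" "\<And>k. (\<Prod>j<k. u j) \<le> K * q ^ k" by auto
  have pochhammer: "invertible (mat_pochhammer C k) \<and>
      opnorm (matrix_inv (mat_pochhammer C k)) \<le> (\<Prod>j<k. u j) / fact k" for k
  proof (induction k)
    case 0
    have "matrix_inv (mat 1) = (mat 1 :: complex ^ 'r ^ 'r)"
      using matrix_inv_right[of "mat 1 :: complex ^ 'r ^ 'r"] by (simp add: invertible_def)
    moreover have "invertible (mat 1 :: complex ^ 'r ^ 'r)"
      by (auto simp: invertible_def)
    ultimately show ?case by (simp add: onorm_id_le)
  next
    case (Suc k)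
    let ?S = "matrix_inv (C + mat (of_nat k))" and ?T = "matrix_inv (mat_pochhammer C k)"
    have "opnorm (matrix_inv (mat_pochhammer C (Suc k))) \<le> opnorm ?S * opnorm ?T"
      using Suc inv by (simp add: matrix_inv_mult opnorm_mult)
    also have "\<dots> \<le> (u k / (real k + 1)) * ((\<Prod>j<k. u j) / fact k)"
      using Suc u0 by (intro mult_mono) (auto intro!: opnorm_nonneg simp: u_def)
    finally show ?case using Suc inv by (simp add: invertible_mult field_simps)
  qed
  have "opnorm (matrix_inv (mat_pochhammer C k)) \<le> K * q ^ k / fact k" for k
    using pochhammer[of k] divide_right_mono[OF K(2)[of k], of "fact k"] by simp
  then show ?thesis using K(1) by blast
qed

section \<open>Absolute convergence of the Lauricella series\<close>

text \<open>
  This multiple geometric series is the majorant; it factors into \<open>n\<close> simple ones.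
\<close>
lemma summable_on_prod_power:
  fixes t :: real
  assumes "0 \<le> t" "t < 1"
  shows "(\<lambda>m. \<Prod>i=1..n. t ^ m i) summable_on multi_indices n"
proof -
  have "Infinite_Set_Sum.abs_summable_on (\<lambda>m. \<Prod>i=1..n. t ^ m i) ({1..n} \<rightarrow>\<^sub>E UNIV)"
    using assms by (intro abs_summable_on_prod_PiE) (auto simp: abs_summable_on_nat_iff' norm_power summable_geometric)
  then show ?thesis
    unfolding multi_indices_def abs_summable_equivalent[symmetric]
    by (rule abs_summable_summable)
qed

text \<open>
  The number of matrices in the product is fixed, so the product of their growth constants is a
  constant that serves all multi-indices \<open>m\<close> at once.
\<close>
lemma mat_prod_upto_growth:
  fixes B :: "nat \<Rightarrow> complex ^ 'r ^ 'r"
  assumes "q > 1"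
  shows "\<exists>K\<ge>0. \<forall>m. opnorm (mat_prod_upto (\<lambda>i. mat_pochhammer (B i) (m i)) n)
                  \<le> K * q ^ (\<Sum>i=1..n. m i) * (\<Prod>i=1..n. fact (m i))"
proof (induction n)
  case 0
  show ?case by (rule exI[of _ 1]) (simp add: onorm_id_le)
next
  case (Suc n)
  obtain K where K: "K \<ge> 0"
    "\<And>m. opnorm (mat_prod_upto (\<lambda>i. mat_pochhammer (B i) (m i)) n)
            \<le> K * q ^ (\<Sum>i=1..n. m i) * (\<Prod>i=1..n. fact (m i))"
    using Suc.IH by blast
  obtain L where L: "L \<ge> 0" "\<And>k. opnorm (mat_pochhammer (B (Suc n)) k) \<le> L * q ^ k * fact k"
    using mat_pochhammer_growth[OF assms] by blast
  show ?case
  proof (intro exI[of _ "K * L"] conjI allI)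
    show "K * L \<ge> 0" using K L by simp
  next
    fix m
    have "opnorm (mat_prod_upto (\<lambda>i. mat_pochhammer (B i) (m i)) (Suc n))
        \<le> opnorm (mat_prod_upto (\<lambda>i. mat_pochhammer (B i) (m i)) n)
          * opnorm (mat_pochhammer (B (Suc n)) (m (Suc n)))"
      by (simp add: opnorm_mult)
    also have "\<dots> \<le> (K * q ^ (\<Sum>i=1..n. m i) * (\<Prod>i=1..n. fact (m i)))
          * (L * q ^ m (Suc n) * fact (m (Suc n)))"
      using K L assms by (intro mult_mono opnorm_nonneg) (auto intro!: mult_nonneg_nonneg prod_nonneg)
    also have "\<dots> = K * L * q ^ (\<Sum>i=1..Suc n. m i) * (\<Prod>i=1..Suc n. fact (m i))"
      by (simp add: power_add mult_ac)
    finally show "opnorm (mat_prod_upto (\<lambda>i. mat_pochhammer (B i) (m i)) (Suc n))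
        \<le> K * L * q ^ (\<Sum>i=1..Suc n. m i) * (\<Prod>i=1..Suc n. fact (m i))" .
  qed
qed

lemma norm_map_matrix_mult:
  fixes M :: "complex ^ 'n ^ 'm"
  shows "norm (map_matrix ((*) z) M) = norm z * norm M"
  by (simp add: norm_vec_def norm_mult L2_set_right_distrib)

theorem theorem3p8:
  fixes n :: nat
    and A C :: "complex ^ 'r ^ 'r"
    and B :: "nat \<Rightarrow> complex ^ 'r ^ 'r"
    and x :: "nat \<Rightarrow> complex"
  assumes "n \<ge> 1"
    and "positive_stable A"
    and "\<And>i. i \<in> {1..n} \<Longrightarrow> positive_stable (B i)"
    and "positive_stable C"
    and "spec_alpha A < spec_beta C"
    and "\<And>i. i \<in> {1..n} \<Longrightarrow> spec_alpha (B i) < 1"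
    and "\<And>i. i \<in> {1..n} \<Longrightarrow> norm (x i) < 1"
  shows "(\<lambda>m. norm (FD_term n A B C x m)) summable_on multi_indices n"
proof -
  define s where "s = Max ((\<lambda>i. norm (x i)) ` {1..n})"
  have s1: "s < 1" using assms(1,7) by (auto simp: s_def)
  have xs: "norm (x i) \<le> s" if "i \<in> {1..n}" for i
    using that by (auto simp: s_def)
  have s0: "0 \<le> s" using xs[of 1] assms(1) order_trans[OF norm_ge_zero[of "x 1"]] by simp
  \<comment> \<open>Three factors are estimated with base \<open>q\<close> (from \<open>A\<close>, from the \<open>B i\<close> and from \<open>C\<close>), hence the cube.\<close>
  have "((\<lambda>q. q ^ 3 * s) \<longlongrightarrow> 1 ^ 3 * s) (at_right 1)"
    by (intro tendsto_intros)
  then have "\<forall>\<^sub>F q in at_right 1. q ^ 3 * s < 1"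
    by (rule order_tendstoD(2)) (use s1 in simp)
  moreover have "\<forall>\<^sub>F q in at_right (1::real). q > 1"
    by (simp add: eventually_at_right_less)
  ultimately have "\<forall>\<^sub>F q in at_right 1. q ^ 3 * s < 1 \<and> q > 1"
    by eventually_elim simp
  then obtain q where q: "q ^ 3 * s < 1" "q > 1"
    using eventually_happens[of _ "at_right (1::real)"] by auto
  obtain a where a: "a \<ge> 0" "\<And>k. opnorm (mat_pochhammer A k) \<le> a * q ^ k * fact k"
    using mat_pochhammer_growth[OF q(2)] by blast
  obtain b where b: "b \<ge> 0"
    "\<And>m. opnorm (mat_prod_upto (\<lambda>i. mat_pochhammer (B i) (m i)) n)
            \<le> b * q ^ (\<Sum>i=1..n. m i) * (\<Prod>i=1..n. fact (m i))"
    using mat_prod_upto_growth[OF q(2)] by blast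
  obtain c where c: "c \<ge> 0" "\<And>k. opnorm (matrix_inv (mat_pochhammer C k)) \<le> c * q ^ k / fact k"
    using inverse_mat_pochhammer_growth[OF positive_stable_imp_invertible_shift[OF assms(4)] q(2)] by blast
  define K where "K = real CARD('r) * real CARD('r) * (a * b * c)"
  have bound: "norm (FD_term n A B C x m) \<le> K * (\<Prod>i=1..n. (q ^ 3 * s) ^ m i)" for m
  proof -
    define k where "k = (\<Sum>i=1..n. m i)"
    define f where "f = (\<Prod>i=1..n. fact (m i) :: real)"
    define X where "X = mat_pochhammer A k ** mat_prod_upto (\<lambda>i. mat_pochhammer (B i) (m i)) n
                          ** matrix_inv (mat_pochhammer C k)"
    have f: "f > 0" unfolding f_def by (intro prod_pos) simp
    have "opnorm X \<le> (opnorm (mat_pochhammer A k)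
        * opnorm (mat_prod_upto (\<lambda>i. mat_pochhammer (B i) (m i)) n))
        * opnorm (matrix_inv (mat_pochhammer C k))"
      unfolding X_def by (intro order_trans[OF opnorm_mult] mult_right_mono opnorm_mult opnorm_nonneg)
    also have "\<dots> \<le> ((a * q ^ k * fact k) * (b * q ^ k * f)) * (c * q ^ k / fact k)"
      using a b c q(2) f unfolding k_def f_def
      by (intro mult_mono opnorm_nonneg mult_nonneg_nonneg) auto
    also have "\<dots> = a * b * c * (q ^ 3) ^ k * f"
      by (simp add: power3_eq_cube power_mult_distrib field_simps)
    finally have "real CARD('r) * real CARD('r) * opnorm X \<le>
        real CARD('r) * real CARD('r) * (a * b * c * (q ^ 3) ^ k * f)"
      by (rule mult_left_mono) simp
    with norm_le_opnorm[of X] have "norm X \<le> real CARD('r) * real CARD('r) * (a * b * c * (q ^ 3) ^ k * f)"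
      by (rule order_trans)
    then have X: "norm X \<le> K * (q ^ 3) ^ k * f"
      by (simp add: K_def mult_ac)
    have "norm (FD_term n A B C x m) = (\<Prod>i=1..n. norm (x i) ^ m i) / f * norm X"
      unfolding FD_term_def norm_map_matrix_mult X_def k_def f_def
      by (simp add: norm_divide norm_power prod_norm[symmetric])
    also have "\<dots> \<le> (\<Prod>i=1..n. s ^ m i) / f * (K * (q ^ 3) ^ k * f)"
      using X xs f s0
      by (intro mult_mono divide_right_mono prod_mono conjI power_mono divide_nonneg_nonneg)
         (auto intro!: prod_nonneg)
    also have "\<dots> = K * (\<Prod>i=1..n. (q ^ 3 * s) ^ m i)"
      using f by (simp add: k_def power_sum power_mult_distrib prod.distrib)
    finally show ?thesis .
  qed
  have "(\<lambda>m. K * (\<Prod>i=1..n. (q ^ 3 * s) ^ m i)) summable_on multi_indices n"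
    using q s0 by (intro summable_on_cmult_right summable_on_prod_power) auto
  then show ?thesis
    by (rule Infinite_Sum.abs_summable_on_comparison_test') (rule bound)
qed

end
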